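(* Let $\vartheta$ be a primitive random substitution whose RS-subshift $X_\vartheta$ is non-empty. Then $(X_\vartheta,S)$ contains an element whose shift-orbit $\{S^k w: k\in\mathbb Z\}$ is dense in $X_\vartheta$.
   Context: Let $\mathcal A=\{a_1,\dots,a_n\}$ be a finite alphabet, $\mathcal A^+$ the set of non-empty finite words over $\mathcal A$, and $\mathcal A^{\mathbb Z}$ the set of bi-infinite sequences with the product topology ($\mathcal A$ discrete). A random substitution (non-degenerate; the probabilities, all non-zero, play no role here and are suppressed) is a map $\vartheta$ assigning to each letter $a_i$ a non-empty finite set $\vartheta(a_i)\subset\mathcal A^+$ of realisations. A realisation of $\vartheta(u)$, for $u=u_1\cdots u_m\in\mathcal A^+$, is a word $x_1\cdots x_m$ with each $x_j\in\vartheta(u_j)$ chosen independently for each position. Realisations of $\vartheta^k(u)$ are defined inductively: $\vartheta^0$ is the identity, and the realisations of $\vartheta^{k+1}(u)$ are the realisations of $\vartheta(v)$ for $v$ a realisation of $\vartheta^k(u)$. $\vartheta$ is primitive if there is $k\in\mathbb N$ such that for all $1\le i,j\le n$ the letter $a_i$ is a subword of some realisation of $\vartheta^k(a_j)$. A word $u\in\mathcal A^+$ is $\vartheta$-legal if it is a subword of some realisation of $\vartheta^k(a_j)$ for some $k\in\mathbb N$ and some $j$. The RS-subshift is $X_\vartheta=\{w\in\mathcal A^{\mathbb Z}: \text{every finite non-empty subword of } w \text{ is } \vartheta\text{-legal}\}$, with the shift $S(w)_i=w_{i+1}$. *)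

theory Defs
  imports "HOL-Analysis.Analysis" "HOL-Library.Sublist"
begin

text \<open>The alphabet is a finite type \<open>'a\<close>, finite words are lists, and \<open>\<theta> a\<close> is the set of
  realisations of the letter \<open>a\<close>. The (non-zero) probabilities are suppressed.\<close>

definition random_substitution :: "('a::finite \<Rightarrow> 'a list set) \<Rightarrow> bool" where
  "random_substitution \<theta> \<longleftrightarrow> (\<forall>a. finite (\<theta> a) \<and> \<theta> a \<noteq> {} \<and> [] \<notin> \<theta> a)"

definition realisations :: "('a \<Rightarrow> 'a list set) \<Rightarrow> 'a list \<Rightarrow> 'a list set" where
  "realisations \<theta> u = {concat xs | xs. list_all2 (\<lambda>x a. x \<in> \<theta> a) xs u}"

primrec realisations_pow :: "('a \<Rightarrow> 'a list set) \<Rightarrow> nat \<Rightarrow> 'a list \<Rightarrow> 'a list set" where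
  "realisations_pow \<theta> 0 u = {u}"
| "realisations_pow \<theta> (Suc k) u = (\<Union>v\<in>realisations_pow \<theta> k u. realisations \<theta> v)"

definition primitive_substitution :: "('a::finite \<Rightarrow> 'a list set) \<Rightarrow> bool" where
  "primitive_substitution \<theta> \<longleftrightarrow>
     (\<exists>k. \<forall>a b. \<exists>v\<in>realisations_pow \<theta> k [b]. sublist [a] v)"

definition legal :: "('a::finite \<Rightarrow> 'a list set) \<Rightarrow> 'a list \<Rightarrow> bool" where
  "legal \<theta> u \<longleftrightarrow> u \<noteq> [] \<and> (\<exists>k a. \<exists>v\<in>realisations_pow \<theta> k [a]. sublist u v)"

definition subword_at :: "(int \<Rightarrow> 'a) \<Rightarrow> int \<Rightarrow> nat \<Rightarrow> 'a list" where
  "subword_at w i m = map (\<lambda>j. w (i + int j)) [0..<m]"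

definition RS_subshift :: "('a::finite \<Rightarrow> 'a list set) \<Rightarrow> (int \<Rightarrow> 'a) set" where
  "RS_subshift \<theta> = {w. \<forall>i m. m \<ge> 1 \<longrightarrow> legal \<theta> (subword_at w i m)}"

definition full_shift_topology :: "(int \<Rightarrow> 'a) topology" where
  "full_shift_topology = product_topology (\<lambda>_. discrete_topology UNIV) UNIV"

definition shift :: "(int \<Rightarrow> 'a) \<Rightarrow> (int \<Rightarrow> 'a)" where
  "shift w = (\<lambda>i. w (i + 1))"

definition shift_pow :: "int \<Rightarrow> (int \<Rightarrow> 'a) \<Rightarrow> (int \<Rightarrow> 'a)" where
  "shift_pow k = (if k \<ge> 0 then shift ^^ nat k else inv shift ^^ nat (- k))"

definition shift_orbit :: "(int \<Rightarrow> 'a) \<Rightarrow> (int \<Rightarrow> 'a) set" where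
  "shift_orbit w = {shift_pow k w | k. True}"

lemma bij_shift: "bij shift"
  by (rule bij_betw_byWitness[where f' = "\<lambda>w i. w (i - 1)"]) (auto simp: shift_def)

lemma inv_shift: "inv shift w = (\<lambda>i. w (i - 1))"
  by (rule inv_f_eq[OF bij_is_inj[OF bij_shift]]) (simp add: shift_def)

lemma shift_pow_apply: "shift_pow k w = (\<lambda>i. w (i + k))"
proof -
  have "(shift ^^ n) w = (\<lambda>i. w (i + int n))" for n
    by (induction n) (auto simp: shift_def algebra_simps)
  moreover have "(inv shift ^^ n) w = (\<lambda>i. w (i - int n))" for n
    by (induction n) (auto simp: inv_shift algebra_simps)
  ultimately show ?thesis
    by (auto simp: shift_pow_def)
qed

end

theory Submission
  imports Defs
begin

text \<open>By primitivity every legal word occurs in some realisation of \<open>\<theta>\<^sup>m(b)\<close> for every letter \<open>b\<close>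
  and all large \<open>m\<close>. Since the subshift is non-empty, there is a legal word \<open>abc\<close> of length three;
  substituting its letters independently places one given legal word inside the realisation of \<open>a\<close>
  and another inside that of \<open>b\<close>, so any legal word extends on both sides to a legal word
  containing any other. Iterating over an enumeration of all legal words, the increasing words
  converge to a bi-infinite sequence whose subwords are exactly the legal words.\<close>

section \<open>Realisations of words under powers of the substitution\<close>

lemma realisations_append:
  assumes "x \<in> realisations \<theta> u" "y \<in> realisations \<theta> v"
  shows "x @ y \<in> realisations \<theta> (u @ v)"
proof -
  obtain xs ys where "x = concat xs" "list_all2 (\<lambda>x a. x \<in> \<theta> a) xs u"
    "y = concat ys" "list_all2 (\<lambda>x a. x \<in> \<theta> a) ys v"
    using assms by (auto simp: realisations_def)
  then have "x @ y = concat (xs @ ys)" "list_all2 (\<lambda>x a. x \<in> \<theta> a) (xs @ ys) (u @ v)"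
    by (auto intro: list_all2_appendI)
  then show ?thesis unfolding realisations_def by blast
qed

text \<open>Positions are realised independently, so two derivations with the same number of steps
  can run side by side.\<close>

lemma realisations_pow_append:
  assumes "x \<in> realisations_pow \<theta> k u" "y \<in> realisations_pow \<theta> k v"
  shows "x @ y \<in> realisations_pow \<theta> k (u @ v)"
  using assms by (induction k arbitrary: x y) (auto, blast intro: realisations_append)

lemma realisations_pow_trans:
  assumes "v \<in> realisations_pow \<theta> j u" "x \<in> realisations_pow \<theta> k v"
  shows "x \<in> realisations_pow \<theta> (j + k) u"
  using assms by (induction k arbitrary: x) auto

lemma realisations_nonempty:
  assumes "random_substitution \<theta>"
  shows "realisations \<theta> u \<noteq> {}"
proof -
  have "list_all2 (\<lambda>x a. x \<in> \<theta> a) (map (\<lambda>a. SOME x. x \<in> \<theta> a) u) u"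
    using assms
    by (auto simp: list_all2_conv_all_nth random_substitution_def intro: some_in_eq[THEN iffD2])
  then show ?thesis unfolding realisations_def by blast
qed

lemma Nil_notin_realisations:
  assumes "random_substitution \<theta>" "u \<noteq> []"
  shows "[] \<notin> realisations \<theta> u"
proof
  assume "[] \<in> realisations \<theta> u"
  then obtain xs where "concat xs = []" "list_all2 (\<lambda>x a. x \<in> \<theta> a) xs u"
    by (auto simp: realisations_def)
  with assms show False
    by (cases u; cases xs) (auto simp: random_substitution_def)
qed

lemma realisations_pow_nonempty:
  assumes "random_substitution \<theta>"
  shows "realisations_pow \<theta> k u \<noteq> {}"
  using realisations_nonempty[OF assms] by (induction k) auto

lemma Nil_notin_realisations_pow:
  assumes "random_substitution \<theta>" "u \<noteq> []"
  shows "[] \<notin> realisations_pow \<theta> k u"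
proof (induction k)
  case (Suc k)
  then show ?case using Nil_notin_realisations[OF assms(1)] by (auto, metis)
qed (use assms in auto)

text \<open>The letters around \<open>u\<close> in \<open>v\<close> can be given any realisations;
  placing \<open>x\<close> between them realises \<open>v\<close>.\<close>

lemma sublist_realisations_pow:
  assumes "random_substitution \<theta>" "sublist u v" "x \<in> realisations_pow \<theta> k u"
  shows "\<exists>y\<in>realisations_pow \<theta> k v. sublist x y"
proof -
  obtain p q where v: "v = p @ u @ q" using assms(2) by (auto simp: sublist_def)
  obtain p' q' where "p' \<in> realisations_pow \<theta> k p" "q' \<in> realisations_pow \<theta> k q"
    using realisations_pow_nonempty[OF assms(1)] by blast
  then have "p' @ x @ q' \<in> realisations_pow \<theta> k v"
    unfolding v using assms(3) by (intro realisations_pow_append)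
  then show ?thesis by (auto intro: bexI[of _ "p' @ x @ q'"])
qed

section \<open>Legal words and their extensions\<close>

lemma legal_sublist:
  assumes "legal \<theta> v" "sublist u v" "u \<noteq> []"
  shows "legal \<theta> u"
  using assms by (meson legal_def sublist_order.order_trans)

lemma legal_realisations_pow:
  assumes "random_substitution \<theta>" "legal \<theta> u" "x \<in> realisations_pow \<theta> k u"
  shows "legal \<theta> x"
proof -
  obtain j a v where v: "v \<in> realisations_pow \<theta> j [a]" "sublist u v" and "u \<noteq> []"
    using assms(2) by (auto simp: legal_def)
  obtain y where "y \<in> realisations_pow \<theta> k v" "sublist x y"
    using sublist_realisations_pow[OF assms(1) v(2) assms(3)] by blast
  moreover have "x \<noteq> []"
    using Nil_notin_realisations_pow[OF assms(1) \<open>u \<noteq> []\<close>] assms(3) by metis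
  ultimately show ?thesis
    unfolding legal_def using realisations_pow_trans[OF v(1)] by blast
qed

text \<open>The extra \<open>m - k\<close> steps come first: they turn \<open>b\<close> into a
  non-empty word, any letter of which can yield \<open>u\<close> in \<open>k\<close> more steps.
  That letter is not controlled, so the assumption ranges over all letters.\<close>

lemma sublist_realisations_pow_mono:
  assumes "random_substitution \<theta>" "k \<le> m"
    and "\<forall>b. \<exists>v\<in>realisations_pow \<theta> k [b]. sublist u v"
  shows "\<forall>b. \<exists>v\<in>realisations_pow \<theta> m [b]. sublist u v"
proof
  fix b
  obtain x where x: "x \<in> realisations_pow \<theta> (m - k) [b]"
    using realisations_pow_nonempty[OF assms(1)] by blast
  then have "x \<noteq> []" using Nil_notin_realisations_pow[OF assms(1)] by (metis not_Cons_self2)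
  then obtain c where c: "sublist [c] x" by (cases x) (auto simp: sublist_def, metis append_Nil)
  obtain v where "v \<in> realisations_pow \<theta> k [c]" "sublist u v" using assms(3) by blast
  with sublist_realisations_pow[OF assms(1) c] obtain y where
    "y \<in> realisations_pow \<theta> k x" "sublist u y" by (meson sublist_order.order_trans)
  with realisations_pow_trans[OF x, of y k] assms(2)
  show "\<exists>v\<in>realisations_pow \<theta> m [b]. sublist u v" by auto
qed

text \<open>Primitivity leads from any \<open>b\<close> to the letter from which \<open>u\<close>
  arose, in a number of steps independent of \<open>b\<close>. This uniformity lets two words be
  produced later with one common exponent.\<close>

lemma legal_in_all_large_powers:
  assumes "random_substitution \<theta>" "primitive_substitution \<theta>" "legal \<theta> u"
  obtains k where "\<And>m b. m \<ge> k \<Longrightarrow> \<exists>v\<in>realisations_pow \<theta> m [b]. sublist u v"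
proof -
  obtain k where k: "\<And>a b. \<exists>v\<in>realisations_pow \<theta> k [b]. sublist [a] v"
    using assms(2) by (auto simp: primitive_substitution_def)
  obtain j a x where x: "x \<in> realisations_pow \<theta> j [a]" "sublist u x"
    using assms(3) by (auto simp: legal_def)
  have "\<exists>v\<in>realisations_pow \<theta> (k + j) [b]. sublist u v" for b
  proof -
    obtain v where v: "v \<in> realisations_pow \<theta> k [b]" "sublist [a] v" using k by blast
    then obtain y where "y \<in> realisations_pow \<theta> j v" "sublist x y"
      using sublist_realisations_pow[OF assms(1) _ x(1)] by blast
    then show ?thesis using x(2) realisations_pow_trans[OF v(1)] sublist_order.order_trans by blast
  qed
  then show ?thesis
    using that sublist_realisations_pow_mono[OF assms(1)] by blast
qed

text \<open>Strict growth on both sides is what makes the limit fill all of the integers: the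
  realisation of \<open>a\<close> makes the left side non-empty, that of \<open>c\<close> the right
  side.\<close>

lemma legal_extension:
  assumes "random_substitution \<theta>" "primitive_substitution \<theta>" "legal \<theta> [a, b, c]"
    and "legal \<theta> u" "legal \<theta> v"
  shows "\<exists>p q. p \<noteq> [] \<and> q \<noteq> [] \<and> legal \<theta> (p @ v @ q) \<and> sublist u (p @ v @ q)"
proof -
  obtain k where k: "\<And>m b. m \<ge> k \<Longrightarrow> \<exists>x\<in>realisations_pow \<theta> m [b]. sublist u x"
    using legal_in_all_large_powers[OF assms(1,2,4)] by blast
  obtain l where l: "\<And>m b. m \<ge> l \<Longrightarrow> \<exists>x\<in>realisations_pow \<theta> m [b]. sublist v x"
    using legal_in_all_large_powers[OF assms(1,2,5)] by blast
  \<comment> \<open>All three letters must be substituted the same number of times.\<close>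
  define m where "m = max k l"
  obtain x where x: "x \<in> realisations_pow \<theta> m [a]" "sublist u x"
    using k[of m a] by (auto simp: m_def)
  obtain y where y: "y \<in> realisations_pow \<theta> m [b]" "sublist v y"
    using l[of m b] by (auto simp: m_def)
  obtain z where z: "z \<in> realisations_pow \<theta> m [c]"
    using realisations_pow_nonempty[OF assms(1)] by blast
  obtain p q where y_eq: "y = p @ v @ q" using y(2) by (auto simp: sublist_def)
  have "x @ y @ z \<in> realisations_pow \<theta> m ([a] @ [b] @ [c])"
    using x y z by (intro realisations_pow_append)
  then have "legal \<theta> (x @ y @ z)" using legal_realisations_pow[OF assms(1,3)] by simp
  moreover have "x \<noteq> []" "z \<noteq> []"
    using x z Nil_notin_realisations_pow[OF assms(1)] by (metis not_Cons_self2)+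
  moreover have "sublist u (x @ y @ z)" using x(2) by (simp add: sublist_append)
  ultimately show ?thesis
    unfolding y_eq by - (rule exI[of _ "x @ p"], rule exI[of _ "q @ z"], simp)
qed

section \<open>Bi-infinite limits of growing words\<close>

lemma biinfinite_limit_word:
  fixes P :: "'a::countable list \<Rightarrow> bool"
  assumes "P v0"
    and ext: "\<And>u v. P u \<Longrightarrow> P v \<Longrightarrow>
      \<exists>p q. p \<noteq> [] \<and> q \<noteq> [] \<and> P (p @ v @ q) \<and> sublist u (p @ v @ q)"
  shows "\<exists>w. (\<forall>i m. \<exists>v. P v \<and> sublist (subword_at w i m) v) \<and>
    (\<forall>u. P u \<longrightarrow> (\<exists>i. subword_at w i (length u) = u))"
proof -
  \<comment> \<open>A pair \<open>(v, c)\<close> is the word \<open>v\<close> placed on \<open>\<int>\<close> so that its first letter has position \<open>-c\<close>.\<close>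
  define Q where "Q n s t \<longleftrightarrow> (\<exists>p q. p \<noteq> [] \<and> q \<noteq> [] \<and> fst t = p @ fst s @ q \<and>
    snd t = snd s + length p \<and> (P (from_nat n) \<longrightarrow> sublist (from_nat n) (fst t)))"
    for n and s t :: "'a list \<times> nat"
  have step: "\<exists>t. P (fst t) \<and> Q n s t" if "P (fst s)" for n s
  proof -
    \<comment> \<open>If the \<open>n\<close>-th word fails \<open>P\<close>, the dummy
      \<open>v0\<close> replaces it, so that the word still grows at this stage.\<close>
    define u where "u = (if P (from_nat n) then from_nat n else v0)"
    have "P u" using assms(1) by (simp add: u_def)
    from ext[OF this that] obtain p q where "p \<noteq> []" "q \<noteq> []" "P (p @ fst s @ q)"
      "sublist u (p @ fst s @ q)" by blast
    then have "Q n s (p @ fst s @ q, snd s + length p)"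
      unfolding Q_def u_def by - (rule exI[of _ p], rule exI[of _ q], simp split: if_splits)
    with \<open>P (p @ fst s @ q)\<close> show ?thesis by (intro exI) auto
  qed
  obtain f where f: "\<And>n. P (fst (f n))" "\<And>n. Q n (f n) (f (Suc n))"
    using dependent_nat_choice[of "\<lambda>_ s. P (fst s)" Q] assms(1) step by (metis fst_conv)
  define W c where "W n = fst (f n)" and "c n = snd (f n)" for n
  have "\<exists>p q. p \<noteq> [] \<and> q \<noteq> [] \<and> W (Suc n) = p @ W n @ q \<and> c (Suc n) = c n + length p" for n
    using f(2)[of n] unfolding Q_def W_def c_def by blast
  then obtain p q where pq: "\<And>n. p n \<noteq> []" "\<And>n. q n \<noteq> []"
    and W_Suc: "\<And>n. W (Suc n) = p n @ W n @ q n"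
    and c_Suc: "\<And>n. c (Suc n) = c n + length (p n)"
    by metis
  have pq_len: "length (p n) \<ge> 1" "length (q n) \<ge> 1" for n
    using pq[of n] by (simp_all add: Suc_le_eq)
  have c_ge: "c n \<ge> n" for n
  proof (induction n)
    case (Suc n)
    then show ?case using pq_len(1)[of n] by (simp add: c_Suc)
  qed simp
  \<comment> \<open>The choice of \<open>f\<close> leaves the initial offset \<open>c 0\<close>
    arbitrary, so it enters the bound: \<open>W n\<close> covers at least the positions from
    \<open>-n\<close> to \<open>n - c 0 - 1\<close>.\<close>
  have len_ge: "length (W n) + c 0 \<ge> c n + n" for n
  proof (induction n)
    case (Suc n)
    then show ?case using pq_len(2)[of n] by (simp add: c_Suc W_Suc)
  qed simp
  define inside where "inside n i \<longleftrightarrow> 0 \<le> i + int (c n) \<and> i + int (c n) < int (length (W n))" for n i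
  define letter where "letter n i = W n ! nat (i + int (c n))" for n i
  have letter_Suc: "inside (Suc n) i \<and> letter (Suc n) i = letter n i" if "inside n i" for n i
  proof -
    \<comment> \<open>The larger offset compensates exactly for the prepended \<open>p n\<close>, so
      letters keep their positions.\<close>
    have "nat (i + int (c (Suc n))) = length (p n) + nat (i + int (c n))"
      using that by (auto simp: inside_def c_Suc)
    then show ?thesis using that by (auto simp: inside_def letter_def nth_append c_Suc W_Suc)
  qed
  have letter_mono: "inside m i \<and> letter m i = letter n i" if "inside n i" "n \<le> m" for n m i
    using that(2,1) by (induction rule: dec_induct) (use letter_Suc in auto)
  have inside: "inside n i" if "n > nat \<bar>i\<bar> + c 0" for n i
    using that len_ge[of n] c_ge[of n] unfolding inside_def by linarith
  \<comment> \<open>The stage chosen is one known to cover \<open>i\<close>; comparison at a common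
    later stage shows that any other covering stage gives the same letter.\<close>
  define w where "w i = letter (Suc (nat \<bar>i\<bar> + c 0)) i" for i
  have w_eq: "w i = letter n i" if "inside n i" for n i
    using letter_mono[OF that, of "max n (Suc (nat \<bar>i\<bar> + c 0))"]
      letter_mono[OF inside[of i "Suc (nat \<bar>i\<bar> + c 0)"], of "max n (Suc (nat \<bar>i\<bar> + c 0))"]
    by (simp add: w_def)
  have "\<exists>v. P v \<and> sublist (subword_at w i m) v" for i m
  proof -
    define n where "n = Suc (nat \<bar>i\<bar> + m + c 0)"
    \<comment> \<open>Including \<open>j = m\<close>, the position just after the window, ensures
      that \<open>take m\<close> below is not cut short.\<close>
    have ins: "inside n (i + int j)" if "j \<le> m" for j
      by (rule inside) (use that in \<open>auto simp: n_def\<close>)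
    have "subword_at w i m = take m (drop (nat (i + int (c n))) (W n))"
    proof (rule nth_equalityI)
      show "length (subword_at w i m) = length (take m (drop (nat (i + int (c n))) (W n)))"
        using ins[of m] ins[of 0] by (auto simp: subword_at_def inside_def)
      fix j assume "j < length (subword_at w i m)"
      then have j: "j < m" by (simp add: subword_at_def)
      have "nat (i + int j + int (c n)) = nat (i + int (c n)) + j"
        using ins[of 0] by (auto simp: inside_def)
      then show "subword_at w i m ! j = take m (drop (nat (i + int (c n))) (W n)) ! j"
        using j w_eq[OF ins[of j]] ins[of j] ins[of 0]
        by (auto simp: subword_at_def letter_def inside_def)
    qed
    then have "sublist (subword_at w i m) (W n)"
      by (metis sublist_drop sublist_take sublist_order.order_trans)
    then show ?thesis using f(1) by (auto simp: W_def)
  qed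
  moreover have "\<exists>i. subword_at w i (length u) = u" if "P u" for u
  proof -
    \<comment> \<open>The word \<open>u\<close> is absorbed at the stage given by its own
      code.\<close>
    have "sublist u (W (Suc (to_nat u)))"
      using f(2)[of "to_nat u"] that by (auto simp: Q_def W_def)
    then obtain n r s where W_eq: "W n = r @ u @ s" by (auto simp: sublist_def)
    have "subword_at w (int (length r) - int (c n)) (length u) = u"
    proof (rule nth_equalityI)
      fix j assume "j < length (subword_at w (int (length r) - int (c n)) (length u))"
      then have j: "j < length u" by (simp add: subword_at_def)
      define i where "i = int (length r) - int (c n) + int j"
      have i: "i + int (c n) = int (length r + j)" by (simp add: i_def)
      have "inside n i" unfolding inside_def i W_eq using j by simp
      then have "w i = u ! j"
        using w_eq j by (simp add: letter_def i W_eq nth_append del: of_nat_add)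
      then show "subword_at w (int (length r) - int (c n)) (length u) ! j = u ! j"
        using j by (simp add: subword_at_def i_def)
    qed (simp add: subword_at_def)
    then show ?thesis by blast
  qed
  ultimately show ?thesis by blast
qed

text \<open>A basic neighbourhood of \<open>z\<close> restricts finitely many coordinates, so it
  suffices that a translate of \<open>w\<close> agrees with \<open>z\<close> on a central
  window.\<close>

lemma closure_of_shift_orbit:
  assumes "w \<in> X"
    and "\<And>z i m. z \<in> X \<Longrightarrow> m \<ge> 1 \<Longrightarrow> \<exists>k. subword_at w k m = subword_at z i m"
    and "\<And>k. shift_pow k w \<in> X"
  shows "subtopology full_shift_topology X closure_of shift_orbit w = X"
proof
  show "subtopology full_shift_topology X closure_of shift_orbit w \<subseteq> X"
    using closure_of_subset_topspace by fastforce
  show "X \<subseteq> subtopology full_shift_topology X closure_of shift_orbit w"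
  proof
    fix z assume z: "z \<in> X"
    have "\<exists>y\<in>shift_orbit w. y \<in> T" if T: "openin (subtopology full_shift_topology X) T" "z \<in> T" for T
    proof -
      obtain O' where O': "openin full_shift_topology O'" "T = O' \<inter> X"
        using T(1) by (auto simp: openin_subtopology)
      then have "\<exists>U. finite {i. U i \<noteq> UNIV} \<and> z \<in> Pi\<^sub>E UNIV U \<and> Pi\<^sub>E UNIV U \<subseteq> O'"
        using T(2) by (auto simp: full_shift_topology_def openin_product_topology_alt)
      then obtain U where U: "finite {i. U i \<noteq> UNIV}" "z \<in> Pi\<^sub>E UNIV U" "Pi\<^sub>E UNIV U \<subseteq> O'"
        by blast
      obtain N where N: "\<And>i. U i \<noteq> UNIV \<Longrightarrow> \<bar>i\<bar> \<le> N"
      proof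
        fix i assume "U i \<noteq> UNIV"
        then show "\<bar>i\<bar> \<le> Max (abs ` {i. U i \<noteq> UNIV})" using U(1) by (intro Max_ge) auto
      qed
      \<comment> \<open>The window runs from \<open>-\<bar>N\<bar>\<close> to
        \<open>\<bar>N\<bar>\<close>. The absolute value guards against an empty set of restricted
        coordinates, whose \<open>Max\<close> is unspecified.\<close>
      define m where "m = nat (2 * \<bar>N\<bar> + 1)"
      have "m \<ge> 1" by (simp add: m_def)
      then obtain k where k: "subword_at w k m = subword_at z (- \<bar>N\<bar>) m"
        using assms(2)[OF z] by blast
      \<comment> \<open>This shift moves position \<open>k\<close> of \<open>w\<close> to the left
        end \<open>-\<bar>N\<bar>\<close> of the window.\<close>
      define y where "y = shift_pow (k + \<bar>N\<bar>) w"
      have y_eq: "y i = z i" if "\<bar>i\<bar> \<le> N" for i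
      proof -
        define j where "j = nat (i + \<bar>N\<bar>)"
        have j: "int j = i + \<bar>N\<bar>" "j < m" using that by (auto simp: j_def m_def)
        have "subword_at w k m ! j = subword_at z (- \<bar>N\<bar>) m ! j" by (simp only: k)
        then show ?thesis using j by (simp add: subword_at_def y_def shift_pow_apply algebra_simps)
      qed
      have "y i \<in> U i" for i
        using N[of i] y_eq[of i] U(2) by (cases "U i = UNIV") (auto simp: PiE_iff)
      then have "y \<in> O'" using U(3) by (auto simp: PiE_iff)
      moreover have "y \<in> X" using assms(3) by (simp add: y_def)
      ultimately show ?thesis using O' by (auto simp: shift_orbit_def y_def)
    qed
    moreover have "z \<in> topspace (subtopology full_shift_topology X)"
      using z by (simp add: full_shift_topology_def)
    ultimately show "z \<in> subtopology full_shift_topology X closure_of shift_orbit w"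
      unfolding in_closure_of by blast
  qed
qed

lemma RS_subshift_shift_pow:
  assumes "w \<in> RS_subshift \<theta>"
  shows "shift_pow k w \<in> RS_subshift \<theta>"
proof -
  have "subword_at (shift_pow k w) i m = subword_at w (i + k) m" for i m
    by (simp add: subword_at_def shift_pow_apply algebra_simps)
  then show ?thesis using assms by (simp add: RS_subshift_def)
qed

theorem proposition12:
  fixes \<theta> :: "'a::finite \<Rightarrow> 'a list set"
  assumes "random_substitution \<theta>"
    and "primitive_substitution \<theta>"
    and "RS_subshift \<theta> \<noteq> {}"
  shows "\<exists>w\<in>RS_subshift \<theta>.
    subtopology full_shift_topology (RS_subshift \<theta>) closure_of shift_orbit w = RS_subshift \<theta>"
proof -
  obtain x where "x \<in> RS_subshift \<theta>" using assms(3) by blast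
  then have "legal \<theta> (subword_at x 0 3)" by (simp add: RS_subshift_def)
  then have abc: "legal \<theta> [x 0, x 1, x 2]" by (simp add: subword_at_def upt_rec)
  \<comment> \<open>The three-letter word has two uses: it drives the extension step and is the
    legal word \<open>v0\<close> required by the limit construction.\<close>
  obtain w where w: "\<And>i m. \<exists>v. legal \<theta> v \<and> sublist (subword_at w i m) v"
    "\<And>u. legal \<theta> u \<Longrightarrow> \<exists>i. subword_at w i (length u) = u"
    using biinfinite_limit_word[of "legal \<theta>", OF abc legal_extension[OF assms(1,2) abc]] by blast
  have len: "length (subword_at z i m) = m" for z :: "int \<Rightarrow> 'a" and i m
    by (simp add: subword_at_def)
  have "legal \<theta> (subword_at w i m)" if "m \<ge> 1" for i m
  proof -
    obtain v where "legal \<theta> v" "sublist (subword_at w i m) v" using w(1) by blast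
    moreover have "subword_at w i m \<noteq> []" using that by (simp add: subword_at_def)
    ultimately show ?thesis by (rule legal_sublist)
  qed
  then have w_in: "w \<in> RS_subshift \<theta>" by (simp add: RS_subshift_def)
  have "\<exists>k. subword_at w k m = subword_at z i m"
    if "z \<in> RS_subshift \<theta>" "m \<ge> 1" for z i m
  proof -
    have "legal \<theta> (subword_at z i m)" using that by (simp add: RS_subshift_def)
    from w(2)[OF this] show ?thesis by (simp add: len)
  qed
  with w_in have "subtopology full_shift_topology (RS_subshift \<theta>) closure_of shift_orbit w
      = RS_subshift \<theta>"
    by (intro closure_of_shift_orbit RS_subshift_shift_pow)
  with w_in show ?thesis by (intro bexI)
qed

end
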